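(* For any $n\ge0$ the following identity holds in $R[t_0]$: $$1\odot(t_0+t_1)^{\cdot n}=t_1\cdot(t_0+t_1)^{\cdot n},$$ where the dot in the exponent means the $n$-fold product in the ring $(R[t_0],+,\cdot)$ (not in the polynomial ring $\mathbb{Q}[t_0,t_1]$).
   Context: $[1,n]:=\{1,\dots,n\}$. For $n\ge0$ let $\mathcal{I}_n:=(\prod_{i=1}^nt_i)\cdot\mathbb{Q}[t_1,\dots,t_n]$, and $R:=\bigoplus_{n\ge0}\mathcal{I}_n$. For a strictly increasing map $\alpha:[1,p]\to[1,n]$ let $\alpha_*:\mathbb{Q}[t_1,\dots,t_p]\to\mathbb{Q}[t_1,\dots,t_n]$, $t_i\mapsto t_{\alpha(i)}$. The product $\cdot$ of $f=(f_n)_n$ and $g=(g_n)_n$ in $R$ is $h=(h_n)_n$ with $h_n=\sum_{\alpha,\beta}(\alpha_*f_p)(\beta_*g_q)$, where $(\alpha,\beta)$ runs through all pairs of strictly increasing maps $\alpha:[1,p]\to[1,n]$, $\beta:[1,q]\to[1,n]$ ($p,q\ge0$) such that the union of their images is $[1,n]$. This makes $R$ a commutative ring with unity and $(R[t_0],+,\cdot)$ is the polynomial ring over it; as a $\mathbb{Q}$-vector space $R[t_0]=\bigoplus_{n\ge0}(\prod_{i=1}^nt_i)\,\mathbb{Q}[t_0,\dots,t_n]$. For $k\ge1$ there is the canonical ring homomorphism $R[t_0]\to\mathbb{Q}[t_0,\dots,t_k]$ sending $f(t_0,t_1,\dots,t_n)\in\mathcal{I}_n[t_0]$ to $\sum_{\alpha:[1,n]\hookrightarrow[1,k]}f(t_0,t_{\alpha(1)},\dots,t_{\alpha(n)})$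 (sum over strictly increasing $\alpha$); an element of $R[t_0]$ is determined by its images for all $k$. The associative, non-commutative, non-unital product $\odot$ on $R[t_0]$ is defined geometrically: $\widetilde{\mathcal{M}}_{0,2}=\mathrm{B}\mathbb{G}_m\times\mathcal{W}$ is the stack of zollstocks (two-pointed nodal curves of genus $0$ which are chains of projective lines with the two marked points, distinct from the nodes, on the first and last component respectively), $A_*(\widetilde{\mathcal{M}}_{0,2})\cong R[t_0]$ is its Chow homology with $\mathbb{Q}$-coefficients, and $\odot$ is the push-forward along the proper morphism $\widetilde{\mathcal{M}}_{0,2}\times\widetilde{\mathcal{M}}_{0,2}\to\widetilde{\mathcal{M}}_{0,2}$ which glues the second marked point of the first zollstock to the first marked point of the second. Explicitly, $\odot$ is the $\mathbb{Q}$-bilinear product such that for $f\in\mathcal{I}_n[t_0]$, $g\in\mathcal{I}_m[t_0]$ and every $k\ge1$ the image of $f\odot g$ in $\mathbb{Q}[t_0,\dots,t_k]$ is $$\sum_{j=1}^k\Big(\sum_{\alpha:[1,n]\hookrightarrow[1,j-1]}f(t_0,t_{\alpha(1)},\dots,t_{\alpha(n)})\Big)\,t_j\,\Big(\sum_{\beta:[1,m]\hookrightarrow[j+1,k]}g\big(\textstyle\sum_{i=0}^jt_i,t_{\beta(1)},\dots,t_{\beta(m)}\big)\Big),$$ with $\alpha,\beta$ running through strictly increasing maps. *)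

theory Defs
  imports "HOL-Library.Poly_Mapping" "HOL-Library.FuncSet"
    "HOL-Computational_Algebra.Polynomial"
begin

declare One_nat_def [simp del]  (* restored at the end of the theory *)

section \<open>Polynomials over the rationals in variables indexed by natural numbers\<close>

text \<open>
  \<open>mpoly\<close> is the polynomial ring \<open>\<rat>[t\<^sub>0, t\<^sub>1, t\<^sub>2, \<dots>]\<close>, with monomials as exponent vectors;
  \<open>polys A\<close> is its subring \<open>\<rat>[t\<^sub>i | i \<in> A]\<close>, and \<open>subst \<sigma>\<close> is the \<open>\<rat>\<close>-algebra homomorphism
  sending each \<open>t\<^sub>i\<close> to \<open>\<sigma> i\<close>. In particular \<open>\<alpha>\<^sub>*\<close> is \<open>subst (\<lambda>i. t (\<alpha> i))\<close>.
\<close>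

type_synonym mpoly = "(nat \<Rightarrow>\<^sub>0 nat) \<Rightarrow>\<^sub>0 rat"

definition t :: "nat \<Rightarrow> mpoly" where
  "t i = Poly_Mapping.single (Poly_Mapping.single i 1) 1"

definition polys :: "nat set \<Rightarrow> mpoly set" where
  "polys A = {p. \<forall>m\<in>Poly_Mapping.keys p. Poly_Mapping.keys m \<subseteq> A}"

definition subst :: "(nat \<Rightarrow> mpoly) \<Rightarrow> mpoly \<Rightarrow> mpoly" where
  "subst \<sigma> p = (\<Sum>m\<in>Poly_Mapping.keys p. Poly_Mapping.single 0 (Poly_Mapping.lookup p m) *
      (\<Prod>i\<in>Poly_Mapping.keys m. \<sigma> i ^ Poly_Mapping.lookup m i))"

lemma single_sum: "Poly_Mapping.single k (\<Sum>x\<in>X. f x) = (\<Sum>x\<in>X. Poly_Mapping.single k (f x))"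
  by (induction X rule: infinite_finite_induct) (auto simp: single_add)

lemma sum_monomials: "p = (\<Sum>m\<in>Poly_Mapping.keys p. Poly_Mapping.single m (Poly_Mapping.lookup p m))"
proof (rule poly_mapping_eqI)
  fix k
  have "Poly_Mapping.lookup (\<Sum>m\<in>Poly_Mapping.keys p. Poly_Mapping.single m (Poly_Mapping.lookup p m)) k
      = (\<Sum>m\<in>Poly_Mapping.keys p. if m = k then Poly_Mapping.lookup p m else 0)"
    by (simp add: lookup_sum lookup_single when_def)
  also have "\<dots> = Poly_Mapping.lookup p k"
    by (simp add: in_keys_iff)
  finally show "Poly_Mapping.lookup p k = Poly_Mapping.lookup (\<Sum>m\<in>Poly_Mapping.keys p. Poly_Mapping.single m (Poly_Mapping.lookup p m)) k" by simp
qed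

lemma mon_superset:
  assumes "finite S" "Poly_Mapping.keys m \<subseteq> S"
  shows "(\<Prod>i\<in>Poly_Mapping.keys m. \<sigma> i ^ Poly_Mapping.lookup m i) = (\<Prod>i\<in>S. (\<sigma> i :: mpoly) ^ Poly_Mapping.lookup m i)"
  using assms by (intro prod.mono_neutral_left) (auto simp: in_keys_iff)

lemma mon_add:
  "(\<Prod>i\<in>Poly_Mapping.keys (m + n). (\<sigma> i :: mpoly) ^ Poly_Mapping.lookup (m + n) i)
    = (\<Prod>i\<in>Poly_Mapping.keys m. \<sigma> i ^ Poly_Mapping.lookup m i) * (\<Prod>i\<in>Poly_Mapping.keys n. \<sigma> i ^ Poly_Mapping.lookup n i)"
proof -
  let ?S = "Poly_Mapping.keys m \<union> Poly_Mapping.keys n"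
  have S: "finite ?S" "Poly_Mapping.keys (m + n) \<subseteq> ?S" "Poly_Mapping.keys m \<subseteq> ?S" "Poly_Mapping.keys n \<subseteq> ?S"
    using keys_add[of m n] by auto
  show ?thesis
    unfolding mon_superset[OF S(1,2)] mon_superset[OF S(1,3)] mon_superset[OF S(1,4)]
    by (simp add: prod.distrib[symmetric] lookup_add power_add)
qed

lemma subst_superset:
  assumes "finite S" "Poly_Mapping.keys p \<subseteq> S"
  shows "subst \<sigma> p = (\<Sum>m\<in>S. Poly_Mapping.single 0 (Poly_Mapping.lookup p m) * (\<Prod>i\<in>Poly_Mapping.keys m. \<sigma> i ^ Poly_Mapping.lookup m i))"
  unfolding subst_def
  using assms by (intro sum.mono_neutral_left) (auto simp: in_keys_iff)

lemma subst_0 [simp]: "subst \<sigma> 0 = 0"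
  by (simp add: subst_def)

lemma subst_add: "subst \<sigma> (p + q) = subst \<sigma> p + subst \<sigma> q"
proof -
  have "Poly_Mapping.keys (p + q) \<subseteq> Poly_Mapping.keys p \<union> Poly_Mapping.keys q" by (rule keys_add)
  then show ?thesis
    by (simp add: subst_superset[of "Poly_Mapping.keys p \<union> Poly_Mapping.keys q" "p + q"]
        subst_superset[of "Poly_Mapping.keys p \<union> Poly_Mapping.keys q" p]
        subst_superset[of "Poly_Mapping.keys p \<union> Poly_Mapping.keys q" q] sum.distrib[symmetric] lookup_add
        single_add algebra_simps)
qed

lemma subst_sum: "subst \<sigma> (\<Sum>x\<in>X. f x) = (\<Sum>x\<in>X. subst \<sigma> (f x))"
  by (induction X rule: infinite_finite_induct) (auto simp: subst_add)

lemma subst_single: "subst \<sigma> (Poly_Mapping.single m c)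
    = Poly_Mapping.single 0 c * (\<Prod>i\<in>Poly_Mapping.keys m. \<sigma> i ^ Poly_Mapping.lookup m i)"
  by (simp add: subst_superset[of "{m}"])

lemma subst_single_mult: "subst \<sigma> (Poly_Mapping.single m c * Poly_Mapping.single n d)
    = subst \<sigma> (Poly_Mapping.single m c) * subst \<sigma> (Poly_Mapping.single n d)"
proof -
  have "Poly_Mapping.single (0 :: nat \<Rightarrow>\<^sub>0 nat) (c * d) = Poly_Mapping.single 0 c * Poly_Mapping.single 0 d"
    by (simp add: mult_single)
  then show ?thesis
    unfolding mult_single[of m] subst_single mon_add by (simp only: mult_ac)
qed

lemma subst_mult: "subst \<sigma> (p * q) = subst \<sigma> p * subst \<sigma> q"
proof -
  let ?s = "\<lambda>p m. Poly_Mapping.single m (Poly_Mapping.lookup p m) :: mpoly"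
  have "p * q = (\<Sum>m\<in>Poly_Mapping.keys p. \<Sum>n\<in>Poly_Mapping.keys q. ?s p m * ?s q n)"
    by (simp add: sum_product[symmetric] sum_monomials[symmetric])
  then have "subst \<sigma> (p * q) = (\<Sum>m\<in>Poly_Mapping.keys p. subst \<sigma> (?s p m)) * (\<Sum>n\<in>Poly_Mapping.keys q. subst \<sigma> (?s q n))"
    by (simp add: subst_sum subst_single_mult sum_product)
  also have "\<dots> = subst \<sigma> p * subst \<sigma> q"
    by (simp add: subst_sum[symmetric] sum_monomials[symmetric])
  finally show ?thesis .
qed

lemma subst_const [simp]: "subst \<sigma> (Poly_Mapping.single 0 c) = Poly_Mapping.single 0 c"
  by (simp add: subst_single)

lemma subst_1 [simp]: "subst \<sigma> 1 = 1"
  using subst_const[of \<sigma> 1] by simp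

lemma subst_t [simp]: "subst \<sigma> (t i) = \<sigma> i"
  by (simp add: t_def subst_single)

lemma subst_power: "subst \<sigma> (p ^ n) = subst \<sigma> p ^ n"
  by (induction n) (auto simp: subst_mult)

lemma subst_prod: "subst \<sigma> (\<Prod>x\<in>X. f x) = (\<Prod>x\<in>X. subst \<sigma> (f x))"
  by (induction X rule: infinite_finite_induct) (auto simp: subst_mult)

lemma subst_subst: "subst \<sigma> (subst \<tau> p) = subst (\<lambda>i. subst \<sigma> (\<tau> i)) p"
  unfolding subst_def[of \<tau>] subst_def[of "\<lambda>i. subst \<sigma> (\<tau> i)"]
  by (simp add: subst_sum subst_mult subst_prod subst_power)

lemma subst_cong:
  assumes "p \<in> polys A" "\<And>i. i \<in> A \<Longrightarrow> \<sigma> i = \<tau> i"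
  shows "subst \<sigma> p = subst \<tau> p"
  unfolding subst_def
proof (intro sum.cong refl arg_cong2[of _ _ _ _ "(*)"] prod.cong)
  fix m i assume "m \<in> Poly_Mapping.keys p" "i \<in> Poly_Mapping.keys m"
  then have "i \<in> A" using assms(1) by (auto simp: polys_def)
  then show "\<sigma> i ^ Poly_Mapping.lookup m i = \<tau> i ^ Poly_Mapping.lookup m i" using assms(2) by simp
qed

lemma t_power: "t i ^ n = Poly_Mapping.single (Poly_Mapping.single i n) 1"
proof (induction n)
  case (Suc n)
  then show ?case
    by (simp add: t_def mult_single single_add[symmetric] plus_1_eq_Suc del: single_one)
qed simp

lemma subst_id [simp]: "subst t p = p"
proof -
  have *: "(\<Prod>i\<in>Poly_Mapping.keys m. t i ^ Poly_Mapping.lookup m i) = Poly_Mapping.single m 1" for m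
  proof -
    have "(\<Prod>i\<in>S. t i ^ f i) = Poly_Mapping.single (\<Sum>i\<in>S. Poly_Mapping.single i (f i)) 1"
      if "finite S" for S and f :: "nat \<Rightarrow> nat"
      using that by induction (auto simp: t_power mult_single)
    then show ?thesis by (simp add: sum_monomials[symmetric])
  qed
  show ?thesis
    unfolding subst_def * by (simp add: mult_single sum_monomials[symmetric])
qed

lemma polys_0 [simp]: "0 \<in> polys A"
  by (simp add: polys_def)

lemma polys_1 [simp]: "1 \<in> polys A"
  by (simp add: polys_def)

lemma polys_const [simp]: "Poly_Mapping.single 0 c \<in> polys A"
  by (simp add: polys_def)

lemma polys_t [simp]: "i \<in> A \<Longrightarrow> t i \<in> polys A"
  by (simp add: polys_def t_def)

lemma polys_add: "p \<in> polys A \<Longrightarrow> q \<in> polys A \<Longrightarrow> p + q \<in> polys A"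
  using keys_add[of p q] by (fastforce simp: polys_def)

lemma polys_uminus: "p \<in> polys A \<Longrightarrow> - p \<in> polys A"
  by (auto simp: polys_def in_keys_iff)

lemma polys_mult:
  assumes "p \<in> polys A" "q \<in> polys A"
  shows "p * q \<in> polys A"
  unfolding polys_def
proof safe
  fix m i assume m: "m \<in> Poly_Mapping.keys (p * q)" "i \<in> Poly_Mapping.keys m"
  then obtain a b where ab: "m = a + b" "a \<in> Poly_Mapping.keys p" "b \<in> Poly_Mapping.keys q"
    using keys_mult[of p q] by blast
  then have "Poly_Mapping.keys a \<subseteq> A" "Poly_Mapping.keys b \<subseteq> A" using assms by (auto simp: polys_def)
  then show "i \<in> A" using keys_add[of a b] m ab by auto
qed

lemma polys_mono: "A \<subseteq> B \<Longrightarrow> p \<in> polys A \<Longrightarrow> p \<in> polys B"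
  by (auto simp: polys_def)

lemma polys_sum: "(\<And>x. x \<in> X \<Longrightarrow> f x \<in> polys A) \<Longrightarrow> (\<Sum>x\<in>X. f x) \<in> polys A"
  by (induction X rule: infinite_finite_induct) (auto intro: polys_add)

lemma polys_prod: "(\<And>x. x \<in> X \<Longrightarrow> f x \<in> polys A) \<Longrightarrow> (\<Prod>x\<in>X. f x) \<in> polys A"
  by (induction X rule: infinite_finite_induct) (auto intro: polys_mult)

lemma polys_power: "p \<in> polys A \<Longrightarrow> p ^ n \<in> polys A"
  by (induction n) (auto intro: polys_mult)

lemma polys_subst:
  assumes "p \<in> polys A" "\<And>i. i \<in> A \<Longrightarrow> \<sigma> i \<in> polys B"
  shows "subst \<sigma> p \<in> polys B"
  unfolding subst_def
proof (intro polys_sum polys_mult polys_prod polys_power polys_const)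
  fix m i assume "m \<in> Poly_Mapping.keys p" "i \<in> Poly_Mapping.keys m"
  then have "i \<in> A" using assms(1) by (auto simp: polys_def)
  then show "\<sigma> i \<in> polys B" by (rule assms(2))
qed

text \<open>For \<open>A = {1..n}\<close> this is the ideal \<open>\<I>\<^sub>n\<close> of \<open>\<rat>[t\<^sub>1, \<dots>, t\<^sub>n]\<close>.\<close>

definition ideal_t :: "nat set \<Rightarrow> mpoly set" where
  "ideal_t A = (\<lambda>q. (\<Prod>i\<in>A. t i) * q) ` polys A"

lemma ideal_tI: "p = (\<Prod>i\<in>A. t i) * q \<Longrightarrow> q \<in> polys A \<Longrightarrow> p \<in> ideal_t A"
  by (auto simp: ideal_t_def)

lemma ideal_tE:
  assumes "p \<in> ideal_t A"
  obtains q where "p = (\<Prod>i\<in>A. t i) * q" "q \<in> polys A"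
  using assms by (auto simp: ideal_t_def)

lemma ideal_t_0 [simp]: "0 \<in> ideal_t A"
  by (rule ideal_tI[of _ _ 0]) auto

lemma ideal_t_add:
  assumes "p \<in> ideal_t A" "q \<in> ideal_t A"
  shows "p + q \<in> ideal_t A"
proof -
  obtain p' q' where *: "p = (\<Prod>i\<in>A. t i) * p'" "p' \<in> polys A"
    "q = (\<Prod>i\<in>A. t i) * q'" "q' \<in> polys A"
    using assms by (elim ideal_tE)
  then show ?thesis
    by (intro ideal_tI[of _ _ "p' + q'"]) (simp_all add: polys_add distrib_left)
qed

lemma ideal_t_uminus:
  assumes "p \<in> ideal_t A"
  shows "- p \<in> ideal_t A"
proof -
  obtain p' where *: "p = (\<Prod>i\<in>A. t i) * p'" "p' \<in> polys A"
    using assms by (elim ideal_tE)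
  then show ?thesis
    by (intro ideal_tI[of _ _ "- p'"]) (simp_all add: polys_uminus)
qed

lemma ideal_t_sum: "(\<And>x. x \<in> X \<Longrightarrow> f x \<in> ideal_t A) \<Longrightarrow> (\<Sum>x\<in>X. f x) \<in> ideal_t A"
  by (induction X rule: infinite_finite_induct) (auto intro: ideal_t_add)

lemma ideal_t_polys: "p \<in> ideal_t A \<Longrightarrow> p \<in> polys A"
  by (elim ideal_tE) (auto intro!: polys_mult polys_prod)

lemma ideal_t_mult:
  assumes "finite A" "finite B" "p \<in> ideal_t A" "q \<in> ideal_t B"
  shows "p * q \<in> ideal_t (A \<union> B)"
proof -
  obtain p' q' where *: "p = (\<Prod>i\<in>A. t i) * p'" "p' \<in> polys A"
    "q = (\<Prod>i\<in>B. t i) * q'" "q' \<in> polys B"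
    using assms by (elim ideal_tE) auto
  have "p * q = ((\<Prod>i\<in>A. t i) * (\<Prod>i\<in>B. t i)) * (p' * q')"
    by (simp add: * mult_ac)
  also have "(\<Prod>i\<in>A. t i) * (\<Prod>i\<in>B. t i) = (\<Prod>i\<in>A \<union> B. t i) * (\<Prod>i\<in>A \<inter> B. t i)"
    using assms by (simp add: prod.union_inter)
  finally show ?thesis
    using * by (intro ideal_tI[of _ _ "(\<Prod>i\<in>A \<inter> B. t i) * (p' * q')"])
      (auto simp: mult_ac intro!: polys_mult polys_prod intro: polys_mono[of A] polys_mono[of B])
qed

lemma ideal_t_subst:
  assumes "p \<in> ideal_t A" "inj_on \<alpha> A"
  shows "subst (\<lambda>i. t (\<alpha> i)) p \<in> ideal_t (\<alpha> ` A)"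
proof -
  obtain q where *: "p = (\<Prod>i\<in>A. t i) * q" "q \<in> polys A"
    using assms by (elim ideal_tE) auto
  show ?thesis
    using * assms(2)
    by (intro ideal_tI[of _ _ "subst (\<lambda>i. t (\<alpha> i)) q"])
      (auto simp: subst_mult subst_prod prod.reindex intro!: polys_subst[of q A])
qed

lemma polys_empty_subst:
  assumes "p \<in> polys {}"
  shows "subst \<sigma> p = p"
  using subst_cong[OF assms, of \<sigma> t] by simp

section \<open>Strictly increasing maps\<close>

text \<open>
  Strictly increasing maps \<open>[1,p] \<rightarrow> A\<close>. They are extensional, so that sums over \<open>incr_maps p A\<close>
  count each map once.
\<close>

definition incr_maps :: "nat \<Rightarrow> nat set \<Rightarrow> (nat \<Rightarrow> nat) set" where
  "incr_maps p A = {\<alpha> \<in> {1..p} \<rightarrow>\<^sub>E A. strict_mono_on {1..p} \<alpha>}"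

text \<open>The unique strictly increasing map from \<open>[1, card C]\<close> onto \<open>C\<close>.\<close>

definition inc :: "nat set \<Rightarrow> nat \<Rightarrow> nat" where
  "inc C = restrict (\<lambda>i. sorted_list_of_set C ! (i - 1)) {1..card C}"

lemma inc_incr_maps:
  assumes "finite C" "C \<subseteq> A"
  shows "inc C \<in> incr_maps (card C) A"
  unfolding incr_maps_def
proof (intro CollectI conjI)
  show "inc C \<in> {1..card C} \<rightarrow>\<^sub>E A"
  proof (rule PiE_I)
    fix i assume "i \<in> {1..card C}"
    then have "inc C i \<in> set (sorted_list_of_set C)"
      by (auto simp: inc_def intro!: nth_mem)
    then show "inc C i \<in> A" using assms by auto
  qed (auto simp: inc_def)
  show "strict_mono_on {1..card C} (inc C)"
  proof (rule strict_mono_onI)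
    fix r s assume rs: "r \<in> {1..card C}" "s \<in> {1..card C}" "r < s"
    then show "inc C r < inc C s"
      using sorted_wrt_nth_less[OF strict_sorted_list_of_set, of "r - 1" "s - 1" C]
      by (auto simp: inc_def)
  qed
qed

lemma inc_image:
  assumes "finite C"
  shows "inc C ` {1..card C} = C"
proof -
  have "inc C ` {1..card C} = (!) (sorted_list_of_set C) ` ((\<lambda>i. i - 1) ` {1..card C})"
    by (auto simp: inc_def image_image)
  also have "(\<lambda>i. i - 1) ` {1..card C} = {..<card C}"
    by (force simp: image_iff intro: bexI[of _ "Suc _"])
  also have "(!) (sorted_list_of_set C) ` {..<card C} = set (sorted_list_of_set C)"
    by (auto simp: set_conv_nth)
  finally show ?thesis using assms by simp
qed

lemma inc_unique:
  assumes "\<alpha> \<in> incr_maps p A"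
  shows "inc (\<alpha> ` {1..p}) = \<alpha>" "card (\<alpha> ` {1..p}) = p"
proof -
  have sm: "strict_mono_on {1..p} \<alpha>" and ext: "\<alpha> \<in> extensional {1..p}"
    using assms by (auto simp: incr_maps_def PiE_def)
  have inj: "inj_on \<alpha> {1..p}" by (rule strict_mono_on_imp_inj_on[OF sm])
  then show c: "card (\<alpha> ` {1..p}) = p" by (simp add: card_image)
  let ?l = "map \<alpha> [1..<Suc p]"
  have "sorted_wrt (<) ?l"
    unfolding sorted_wrt_map
    by (rule sorted_wrt_mono_rel[OF _ sorted_wrt_upt]) (use sm in \<open>auto simp: strict_mono_on_def\<close>)
  moreover have "set ?l = \<alpha> ` {1..p}" by (auto simp del: upt_Suc)
  ultimately have eq: "sorted_list_of_set (\<alpha> ` {1..p}) = ?l"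
    by (intro strict_sorted_equal) auto
  show "inc (\<alpha> ` {1..p}) = \<alpha>"
  proof
    fix i show "inc (\<alpha> ` {1..p}) i = \<alpha> i"
    proof (cases "i \<in> {1..p}")
      case True
      then show ?thesis unfolding inc_def c eq by (auto simp del: upt_Suc)
    next
      case False
      then show ?thesis using ext unfolding inc_def c eq by (simp add: extensional_def del: atLeastAtMost_iff)
    qed
  qed
qed

lemma incr_maps_finite: "finite A \<Longrightarrow> finite (incr_maps p A)"
  unfolding incr_maps_def by (rule finite_subset[of _ "{1..p} \<rightarrow>\<^sub>E A"]) (auto intro: finite_PiE)

lemma incr_maps_image: "\<alpha> \<in> incr_maps p A \<Longrightarrow> \<alpha> ` {1..p} \<subseteq> A"
  by (auto simp: incr_maps_def)

lemma sum_incr_maps: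
  assumes "finite A"
  shows "(\<Sum>\<alpha>\<in>incr_maps p A. F \<alpha>) = (\<Sum>B | B \<subseteq> A \<and> card B = p. F (inc B))"
proof (rule sum.reindex_bij_witness[of _ inc "\<lambda>\<alpha>. \<alpha> ` {1..p}"])
  fix B assume B: "B \<in> {B. B \<subseteq> A \<and> card B = p}"
  then have "finite B" using assms finite_subset by blast
  then show "inc B ` {1..p} = B" "inc B \<in> incr_maps p A"
    using B inc_image[of B] inc_incr_maps[of B A] by auto
qed (auto simp: inc_unique simp del: image_subset_iff dest: incr_maps_image)

lemma sum_card_subsets:
  assumes "finite A" "card A \<le> n"
  shows "(\<Sum>p\<le>n. \<Sum>B | B \<subseteq> A \<and> card B = p. F B) = (\<Sum>B\<in>Pow A. F B)"
proof -
  have "(\<Sum>B\<in>Pow A. F B) = (\<Sum>p\<le>n. \<Sum>B | B \<in> Pow A \<and> card B = p. F B)"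
    using assms by (intro sum.group[symmetric]) (auto intro: order.trans[OF card_mono])
  then show ?thesis by simp
qed

lemma inc_comp:
  assumes "finite C" "P \<subseteq> {1..card C}" "i \<in> {1..card P}"
  shows "inc C (inc P i) = inc (inc C ` P) i"
proof -
  have fP: "finite P" using assms finite_subset by blast
  let ?g = "restrict (inc C \<circ> inc P) {1..card P}"
  have C: "inc C \<in> incr_maps (card C) C" using inc_incr_maps assms by blast
  have P: "inc P \<in> incr_maps (card P) {1..card C}" using inc_incr_maps assms fP by blast
  have "?g \<in> incr_maps (card P) C"
    using C P unfolding incr_maps_def
    by (auto simp: strict_mono_on_def PiE_def Pi_def)
  moreover have "?g ` {1..card P} = inc C ` P"
    using inc_image[OF fP] by (auto simp: image_image[symmetric] image_comp[symmetric])
  ultimately have "inc (inc C ` P) = ?g" using inc_unique by metis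
  then show ?thesis using assms by simp
qed

section \<open>The ring \<open>R\<close>\<close>

typedef ringR = "{f :: nat \<Rightarrow> mpoly. finite {n. f n \<noteq> 0} \<and> (\<forall>n. f n \<in> ideal_t {1..n})}"
  morphisms component AbsR
  by (rule exI[of _ "\<lambda>_. 0"]) auto

setup_lifting type_definition_ringR

lemma component_ideal: "component f n \<in> ideal_t {1..n}"
  using component[of f] by auto

lemma component_finite: "finite {n. component f n \<noteq> 0}"
  using component[of f] by auto

lemma ringR_eqI: "(\<And>n. component f n = component g n) \<Longrightarrow> f = g"
  by (metis component_inject ext)

lemma component_bound: obtains N where "\<And>n. n \<ge> N \<Longrightarrow> component f n = 0"
proof -
  obtain N where "\<forall>n\<in>{n. component f n \<noteq> 0}. n < N"
    using component_finite[of f] finite_nat_set_iff_bounded by blast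
  then have "component f n = 0" if "n \<ge> N" for n using that by (metis mem_Collect_eq not_le)
  then show ?thesis using that by blast
qed

text \<open>
  The summand \<open>\<alpha>\<^sub>* f\<^sub>p\<close> for the strictly increasing \<open>\<alpha>\<close> with image \<open>C\<close>, where \<open>p = card C\<close>;
  used to turn sums over strictly increasing maps into sums over subsets.
\<close>

definition slot :: "ringR \<Rightarrow> nat set \<Rightarrow> mpoly" where
  "slot f C = subst (\<lambda>i. t (inc C i)) (component f (card C))"

lemma slot_ideal:
  assumes "finite C"
  shows "slot f C \<in> ideal_t C"
proof -
  have "inj_on (inc C) {1..card C}"
    using inc_incr_maps[OF assms order.refl] by (auto simp: incr_maps_def intro: strict_mono_on_imp_inj_on)
  from ideal_t_subst[OF component_ideal this, of f] show ?thesis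
    by (simp add: slot_def inc_image[OF assms])
qed

lemma subst_slot:
  assumes "finite C" "P \<subseteq> {1..card C}"
  shows "subst (\<lambda>i. t (inc C i)) (slot f P) = slot f (inc C ` P)"
proof -
  have "inj_on (inc C) {1..card C}"
    using inc_incr_maps[OF assms(1) order.refl] by (auto simp: incr_maps_def intro: strict_mono_on_imp_inj_on)
  then have c: "card (inc C ` P) = card P"
    using assms(2) by (intro card_image) (rule inj_on_subset)
  show ?thesis
    unfolding slot_def subst_subst subst_t c
    using inc_comp[OF assms]
    by (intro subst_cong[OF ideal_t_polys[OF component_ideal]]) auto
qed

lemma inc_atLeastAtMost: "i \<in> {1..n} \<Longrightarrow> inc {1..n} i = i"
proof -
  have "restrict (\<lambda>i. i) {1..n} \<in> incr_maps n {1..n}"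
    by (auto simp: incr_maps_def strict_mono_on_def)
  from inc_unique(1)[OF this] have "inc {1..n} = restrict (\<lambda>i. i) {1..n}"
    by simp
  then show "i \<in> {1..n} \<Longrightarrow> inc {1..n} i = i" by simp
qed

lemma slot_atLeastAtMost: "slot f {1..n} = component f n"
proof -
  have "slot f {1..n} = subst t (component f n)"
    unfolding slot_def card_atLeastAtMost diff_Suc_1
    using inc_atLeastAtMost[of _ n]
    by (intro subst_cong[OF ideal_t_polys[OF component_ideal]]) auto
  then show ?thesis by simp
qed

lemma sum_slot:
  assumes "finite A"
  shows "(\<Sum>p\<le>card A. \<Sum>\<alpha>\<in>incr_maps p A. G (\<alpha> ` {1..p}) (subst (\<lambda>i. t (\<alpha> i)) (component f p)))
    = (\<Sum>B\<in>Pow A. G B (slot f B))"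
proof -
  have "(\<Sum>p\<le>card A. \<Sum>\<alpha>\<in>incr_maps p A. G (\<alpha> ` {1..p}) (subst (\<lambda>i. t (\<alpha> i)) (component f p)))
     = (\<Sum>p\<le>card A. \<Sum>B | B \<subseteq> A \<and> card B = p. G (inc B ` {1..p}) (subst (\<lambda>i. t (inc B i)) (component f p)))"
    using assms by (simp add: sum_incr_maps)
  also have "\<dots> = (\<Sum>p\<le>card A. \<Sum>B | B \<subseteq> A \<and> card B = p. G B (slot f B))"
  proof (intro sum.cong refl)
    fix p B assume B: "B \<in> {B. B \<subseteq> A \<and> card B = p}"
    then have "finite B" "card B = p" using assms finite_subset by auto
    then show "G (inc B ` {1..p}) (subst (\<lambda>i. t (inc B i)) (component f p)) = G B (slot f B)"
      using inc_image[of B] by (auto simp: slot_def)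
  qed
  also have "\<dots> = (\<Sum>B\<in>Pow A. G B (slot f B))"
    using assms by (intro sum_card_subsets) auto
  finally show ?thesis .
qed

instantiation ringR :: ab_group_add
begin

lift_definition zero_ringR :: ringR is "\<lambda>_. 0" by simp

lift_definition plus_ringR :: "ringR \<Rightarrow> ringR \<Rightarrow> ringR" is "\<lambda>f g n. f n + g n"
proof -
  fix f g :: "nat \<Rightarrow> mpoly"
  assume *: "finite {n. f n \<noteq> 0} \<and> (\<forall>n. f n \<in> ideal_t {1..n})"
    "finite {n. g n \<noteq> 0} \<and> (\<forall>n. g n \<in> ideal_t {1..n})"
  have "finite {n. f n + g n \<noteq> 0}"
    by (rule finite_subset[of _ "{n. f n \<noteq> 0} \<union> {n. g n \<noteq> 0}"]) (use * in auto)
  with * show "finite {n. f n + g n \<noteq> 0} \<and> (\<forall>n. f n + g n \<in> ideal_t {1..n})"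
    by (auto intro: ideal_t_add)
qed

lift_definition uminus_ringR :: "ringR \<Rightarrow> ringR" is "\<lambda>f n. - f n"
  by (auto intro: ideal_t_uminus)

definition minus_ringR :: "ringR \<Rightarrow> ringR \<Rightarrow> ringR" where
  "minus_ringR f g = f + - g"

instance
  by standard (transfer; simp add: minus_ringR_def algebra_simps fun_eq_iff)+

end


text \<open>The element of \<open>R\<close> given by \<open>p \<in> \<I>\<^sub>n\<close>; unspecified for other \<open>p\<close>.\<close>

definition in_degree :: "nat \<Rightarrow> mpoly \<Rightarrow> ringR" where
  "in_degree n p = AbsR (\<lambda>i. if i = n then p else 0)"

lemma component_in_degree:
  assumes "p \<in> ideal_t {1..n}"
  shows "component (in_degree n p) i = (if i = n then p else 0)"
proof -
  have "finite {i. (if i = n then p else 0) \<noteq> 0}"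
    by (rule finite_subset[of _ "{n}"]) auto
  then show ?thesis
    unfolding in_degree_def using assms by (subst AbsR_inverse) auto
qed

text \<open>
  In the product, \<open>p\<close> and \<open>q\<close> can be bounded by \<open>n\<close> because there are no strictly increasing
  maps \<open>[1,p] \<rightarrow> [1,n]\<close> for \<open>p > n\<close>.
\<close>

instantiation ringR :: "{one, times}"
begin

definition one_ringR :: ringR where
  "1 = in_degree 0 1"

definition times_ringR :: "ringR \<Rightarrow> ringR \<Rightarrow> ringR" where
  "f * g = AbsR (\<lambda>n. \<Sum>p\<le>n. \<Sum>q\<le>n.
     \<Sum>(\<alpha>, \<beta>) \<in> {(\<alpha>, \<beta>). \<alpha> \<in> incr_maps p {1..n} \<and> \<beta> \<in> incr_maps q {1..n} \<and>
                      \<alpha> ` {1..p} \<union> \<beta> ` {1..q} = {1..n}}.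
       subst (\<lambda>i. t (\<alpha> i)) (component f p) * subst (\<lambda>i. t (\<beta> i)) (component g q))"

instance ..

end

text \<open>
  For \<open>A = [1,k]\<close> this is the restriction to \<open>R\<close> of the canonical homomorphism
  \<open>R[t\<^sub>0] \<rightarrow> \<rat>[t\<^sub>0, \<dots>, t\<^sub>k]\<close>. The intervals \<open>[1,j-1]\<close> and \<open>[j+1,k]\<close> occur in the product \<open>\<odot>\<close>.
\<close>

definition rho :: "nat set \<Rightarrow> ringR \<Rightarrow> mpoly" where
  "rho A f = (\<Sum>n | component f n \<noteq> 0. \<Sum>\<alpha>\<in>incr_maps n A. subst (\<lambda>i. t (\<alpha> i)) (component f n))"

lemma component_0 [simp]: "component 0 n = 0"
  by transfer simp

lemma component_add [simp]: "component (f + g) n = component f n + component g n"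
  by transfer simp

lemma slot_0 [simp]: "slot 0 C = 0"
  by (simp add: slot_def)

lemma slot_add: "slot (f + g) C = slot f C + slot g C"
  by (simp add: slot_def subst_add)

lemma incr_maps_empty: "finite A \<Longrightarrow> card A < n \<Longrightarrow> incr_maps n A = {}"
  using card_mono[OF _ incr_maps_image] inc_unique(2) by fastforce

lemma rho_slot:
  assumes "finite A"
  shows "rho A f = (\<Sum>B\<in>Pow A. slot f B)"
proof -
  let ?F = "\<lambda>n. \<Sum>\<alpha>\<in>incr_maps n A. subst (\<lambda>i. t (\<alpha> i)) (component f n)"
  let ?S = "{n. component f n \<noteq> 0} \<union> {..card A}"
  have fin: "finite ?S" using component_finite[of f] by simp
  have "rho A f = (\<Sum>n\<in>?S. ?F n)"
    unfolding rho_def using fin by (intro sum.mono_neutral_left) auto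
  also have "\<dots> = (\<Sum>n\<le>card A. ?F n)"
    using fin assms by (intro sum.mono_neutral_right) (auto simp: incr_maps_empty not_le)
  also have "\<dots> = (\<Sum>B\<in>Pow A. slot f B)"
    by (rule sum_slot[OF assms, of "\<lambda>_ x. x"])
  finally show ?thesis .
qed

lemma sum_times_slot:
  "(\<Sum>p\<le>n. \<Sum>q\<le>n.
     \<Sum>(\<alpha>, \<beta>) \<in> {(\<alpha>, \<beta>). \<alpha> \<in> incr_maps p {1..n} \<and> \<beta> \<in> incr_maps q {1..n} \<and>
                      \<alpha> ` {1..p} \<union> \<beta> ` {1..q} = {1..n}}.
       subst (\<lambda>i. t (\<alpha> i)) (component f p) * subst (\<lambda>i. t (\<beta> i)) (component g q))
   = (\<Sum>P\<in>Pow {1..n}. \<Sum>Q\<in>Pow {1..n}. if P \<union> Q = {1..n} then slot f P * slot g Q else 0)"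
  (is "?L = ?R")
proof -
  let ?f = "\<lambda>\<alpha> p. subst (\<lambda>i. t (\<alpha> i)) (component f p)"
  let ?g = "\<lambda>\<alpha> p. subst (\<lambda>i. t (\<alpha> i)) (component g p)"
  have "(\<Sum>(\<alpha>, \<beta>) \<in> {(\<alpha>, \<beta>). \<alpha> \<in> incr_maps p {1..n} \<and> \<beta> \<in> incr_maps q {1..n} \<and>
                      \<alpha> ` {1..p} \<union> \<beta> ` {1..q} = {1..n}}. ?f \<alpha> p * ?g \<beta> q)
     = (\<Sum>\<alpha>\<in>incr_maps p {1..n}. \<Sum>\<beta>\<in>incr_maps q {1..n}.
          if \<alpha> ` {1..p} \<union> \<beta> ` {1..q} = {1..n} then ?f \<alpha> p * ?g \<beta> q else 0)" (is "sum ?h ?X = _") for p q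
  proof -
    have X: "?X = {x \<in> incr_maps p {1..n} \<times> incr_maps q {1..n}. fst x ` {1..p} \<union> snd x ` {1..q} = {1..n}}"
      by (intro set_eqI) (simp add: split_beta mem_Times_iff conj_assoc)
    show ?thesis
      unfolding X sum.cartesian_product
      by (subst sum.inter_filter)
        (simp_all only: incr_maps_finite finite_cartesian_product finite_atLeastAtMost case_prod_unfold)
  qed
  then have "?L = (\<Sum>p\<le>n. \<Sum>\<alpha>\<in>incr_maps p {1..n}. \<Sum>q\<le>n. \<Sum>\<beta>\<in>incr_maps q {1..n}.
          if \<alpha> ` {1..p} \<union> \<beta> ` {1..q} = {1..n} then ?f \<alpha> p * ?g \<beta> q else 0)"
    by (simp only:) (intro sum.cong refl sum.swap)
  also have "\<dots> = (\<Sum>p\<le>n. \<Sum>\<alpha>\<in>incr_maps p {1..n}. \<Sum>Q\<in>Pow {1..n}.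
          if \<alpha> ` {1..p} \<union> Q = {1..n} then ?f \<alpha> p * slot g Q else 0)"
    using sum_slot[of "{1..n}" "\<lambda>Q y. if \<alpha> ` {1..p} \<union> Q = {1..n} then ?f \<alpha> p * y else 0" g for \<alpha> p]
    by simp
  also have "\<dots> = ?R"
    using sum_slot[of "{1..n}" "\<lambda>P x. \<Sum>Q\<in>Pow {1..n}. if P \<union> Q = {1..n} then x * slot g Q else 0" f]
    by simp
  finally show ?thesis .
qed

lemma component_times:
  "component (f * g) n
     = (\<Sum>P\<in>Pow {1..n}. \<Sum>Q\<in>Pow {1..n}. if P \<union> Q = {1..n} then slot f P * slot g Q else 0)"
proof -
  let ?h = "\<lambda>n. \<Sum>P\<in>Pow {1..n}. \<Sum>Q\<in>Pow {1..n}. if P \<union> Q = {1..n} then slot f P * slot g Q else 0"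
  obtain N where N: "\<And>n. n \<ge> N \<Longrightarrow> component f n = 0" using component_bound[of f] by blast
  obtain M where M: "\<And>n. n \<ge> M \<Longrightarrow> component g n = 0" using component_bound[of g] by blast
  have zero: "?h n = 0" if "n \<ge> N + M" for n
  proof (intro sum.neutral ballI)
    fix P Q assume "P \<in> Pow {1..n}" "Q \<in> Pow {1..n}"
    show "(if P \<union> Q = {1..n} then slot f P * slot g Q else 0) = 0"
    proof (cases "P \<union> Q = {1..n}")
      case True
      then have "n \<le> card P + card Q" using card_Un_le[of P Q] by simp
      then have "card P \<ge> N \<or> card Q \<ge> M" using that by linarith
      then show ?thesis by (auto simp: slot_def N M)
    qed simp
  qed
  have "finite {n. ?h n \<noteq> 0}"
  proof (rule finite_subset[of _ "{..<N + M}"])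
    show "{n. ?h n \<noteq> 0} \<subseteq> {..<N + M}"
      using zero by (auto simp: not_less[symmetric] simp del: not_less)
  qed simp
  moreover have "?h n \<in> ideal_t {1..n}" for n
  proof (intro ideal_t_sum)
    fix P Q assume *: "P \<in> Pow {1..n}" "Q \<in> Pow {1..n}"
    then have "finite P" "finite Q" using finite_subset by blast+
    then show "(if P \<union> Q = {1..n} then slot f P * slot g Q else 0) \<in> ideal_t {1..n}"
      using ideal_t_mult[OF _ _ slot_ideal slot_ideal, of P Q f g] by (cases "P \<union> Q = {1..n}") auto
  qed
  ultimately show ?thesis
    unfolding times_ringR_def sum_times_slot by (subst AbsR_inverse) auto
qed

lemma component_times_explicit:
  "component (f * g) n = (\<Sum>p\<le>n. \<Sum>q\<le>n.
     \<Sum>(\<alpha>, \<beta>) \<in> {(\<alpha>, \<beta>). \<alpha> \<in> incr_maps p {1..n} \<and> \<beta> \<in> incr_maps q {1..n} \<and>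
                      \<alpha> ` {1..p} \<union> \<beta> ` {1..q} = {1..n}}.
       subst (\<lambda>i. t (\<alpha> i)) (component f p) * subst (\<lambda>i. t (\<beta> i)) (component g q))"
  by (simp only: component_times sum_times_slot)

lemma inc_bij:
  assumes "finite C"
  shows "bij_betw (inc C) {1..card C} C"
  using inc_incr_maps[OF assms order.refl] inc_image[OF assms]
  by (auto simp: bij_betw_def incr_maps_def intro: strict_mono_on_imp_inj_on)

lemma slot_times:
  assumes "finite C"
  shows "slot (f * g) C = (\<Sum>P\<in>Pow C. \<Sum>Q\<in>Pow C. if P \<union> Q = C then slot f P * slot g Q else 0)"
proof -
  let ?A = "{1..card C}"
  have bij: "bij_betw (image (inc C)) (Pow ?A) (Pow C)"
    by (rule bij_betw_Pow[OF inc_bij[OF assms]])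
  have inj: "inj_on (inc C) ?A" and im: "inc C ` ?A = C"
    using inc_bij[OF assms] by (auto simp: bij_betw_def)
  have "slot (f * g) C = (\<Sum>P\<in>Pow ?A. \<Sum>Q\<in>Pow ?A.
      if P \<union> Q = ?A then subst (\<lambda>i. t (inc C i)) (slot f P) * subst (\<lambda>i. t (inc C i)) (slot g Q) else 0)"
    unfolding slot_def[of "f * g"] component_times
    by (auto simp: subst_sum subst_mult intro!: sum.cong)
  also have "\<dots> = (\<Sum>P\<in>Pow ?A. \<Sum>Q\<in>Pow ?A.
      if inc C ` P \<union> inc C ` Q = C then slot f (inc C ` P) * slot g (inc C ` Q) else 0)"
  proof (intro sum.cong refl)
    fix P Q assume PQ: "P \<in> Pow ?A" "Q \<in> Pow ?A"
    then have "inc C ` P \<union> inc C ` Q = C \<longleftrightarrow> P \<union> Q = ?A"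
      using inj_on_image_eq_iff[OF inj, of "P \<union> Q" ?A] im by (auto simp: image_Un)
    then show "(if P \<union> Q = ?A then subst (\<lambda>i. t (inc C i)) (slot f P) * subst (\<lambda>i. t (inc C i)) (slot g Q) else 0)
      = (if inc C ` P \<union> inc C ` Q = C then slot f (inc C ` P) * slot g (inc C ` Q) else 0)"
      using PQ subst_slot[OF assms] by auto
  qed
  also have "\<dots> = (\<Sum>P\<in>Pow ?A. \<Sum>Q\<in>Pow C.
      if inc C ` P \<union> Q = C then slot f (inc C ` P) * slot g Q else 0)"
    by (intro sum.cong refl sum.reindex_bij_betw[OF bij])
  also have "\<dots> = (\<Sum>P\<in>Pow C. \<Sum>Q\<in>Pow C. if P \<union> Q = C then slot f P * slot g Q else 0)"
    by (rule sum.reindex_bij_betw[OF bij])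
  finally show ?thesis .
qed

lemma rho_0 [simp]: "rho A 0 = 0"
  by (simp add: rho_def)

lemma rho_add: "finite A \<Longrightarrow> rho A (f + g) = rho A f + rho A g"
  by (simp add: rho_slot slot_add sum.distrib)

lemma rho_mult:
  assumes "finite A"
  shows "rho A (f * g) = rho A f * rho A g"
proof -
  have "rho A (f * g) = (\<Sum>C\<in>Pow A. \<Sum>P\<in>Pow A. \<Sum>Q\<in>Pow A. if P \<union> Q = C then slot f P * slot g Q else 0)"
    unfolding rho_slot[OF assms]
  proof (intro sum.cong refl)
    fix C assume C: "C \<in> Pow A"
    then have "finite C" using assms finite_subset by auto
    then show "slot (f * g) C = (\<Sum>P\<in>Pow A. \<Sum>Q\<in>Pow A. if P \<union> Q = C then slot f P * slot g Q else 0)"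
      unfolding slot_times[OF \<open>finite C\<close>] sum.cartesian_product
      using C assms by (intro sum.mono_neutral_left) (auto split: if_splits)
  qed
  also have "\<dots> = (\<Sum>P\<in>Pow A. \<Sum>Q\<in>Pow A. \<Sum>C\<in>Pow A. if P \<union> Q = C then slot f P * slot g Q else 0)"
    by (rule trans[OF sum.swap]) (intro sum.cong refl sum.swap)
  also have "\<dots> = rho A f * rho A g"
    using assms by (auto simp: rho_slot sum_product intro!: sum.cong)
  finally show ?thesis .
qed

lemma ideal_t_empty: "p \<in> polys {} \<Longrightarrow> p \<in> ideal_t {1..0}"
  by (rule ideal_tI[of _ _ p]) (auto simp: One_nat_def)

lemma rho_in_degree:
  assumes "p \<in> ideal_t {1..n}"
  shows "rho A (in_degree n p) = (\<Sum>\<alpha>\<in>incr_maps n A. subst (\<lambda>i. t (\<alpha> i)) p)"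
proof (cases "p = 0")
  case False
  then have "{i. component (in_degree n p) i \<noteq> 0} = {n}"
    by (auto simp: component_in_degree[OF assms])
  then show ?thesis by (simp add: rho_def component_in_degree[OF assms])
next
  case True
  with assms have "component (in_degree n p) i = 0" for i by (simp add: component_in_degree)
  then have "in_degree n p = 0" by (intro ringR_eqI) simp
  then show ?thesis using True by simp
qed

lemma incr_maps_0: "incr_maps 0 A = {\<lambda>_. undefined}"
  by (auto simp: incr_maps_def One_nat_def)

lemma rho_in_degree_0:
  assumes "p \<in> polys {}"
  shows "rho A (in_degree 0 p) = p"
  using rho_in_degree[OF ideal_t_empty[OF assms], of A] polys_empty_subst[OF assms]
  by (simp add: incr_maps_0)

lemma rho_1 [simp]: "rho A 1 = 1"
  by (simp add: one_ringR_def rho_in_degree_0)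

lemma rho_eq_0:
  assumes "\<And>k. k \<ge> 1 \<Longrightarrow> rho {1..k} f = 0"
  shows "f = 0"
proof (rule ringR_eqI)
  have e: "component f 0 = 0"
  proof -
    have "rho {1..1} f = slot f {} + slot f {1}"
      by (simp add: rho_slot Pow_insert)
    then have sum: "slot f {} + slot f {1} = 0" using assms[of 1] by simp
    have "slot f {} \<in> polys {}"
      by (rule ideal_t_polys[OF slot_ideal]) simp
    then have 1: "subst (\<lambda>_. 0) (slot f {}) = slot f {}" by (rule polys_empty_subst)
    obtain q where "slot f {1} = (\<Prod>i\<in>{1}. t i) * q"
      using slot_ideal[of "{1}" f] ideal_tE by blast
    then have 2: "subst (\<lambda>_. 0) (slot f {1}) = 0" by (simp add: subst_mult)
    have "subst (\<lambda>_. 0) (slot f {} + slot f {1}) = 0" unfolding sum by simp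
    then have "slot f {} = 0" unfolding subst_add 1 2 by simp
    moreover have "slot f {} = component f 0"
      using slot_atLeastAtMost[of f 0] by (simp add: One_nat_def)
    ultimately show ?thesis by simp
  qed
  fix n show "component f n = component 0 n"
  proof (induction n rule: less_induct)
    case (less n)
    have "rho {1..n} f = (\<Sum>B\<in>Pow {1..n}. if B = {1..n} then component f n else 0)"
      unfolding rho_slot[OF finite_atLeastAtMost]
    proof (intro sum.cong refl)
      fix B assume B: "B \<in> Pow {1..n}"
      show "slot f B = (if B = {1..n} then component f n else 0)"
      proof (cases "B = {1..n}")
        case True
        then show ?thesis by (simp add: slot_atLeastAtMost)
      next
        case False
        then have "card B < card {1..n}" using B by (intro psubset_card_mono) auto
        then show ?thesis using less False by (auto simp: slot_def)
      qed
    qed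
    also have "\<dots> = component f n" by (simp add: sum.delta)
    finally have "component f n = rho {1..n} f" ..
    then show ?case using assms[of n] e by (cases "n = 0") simp_all
  qed
qed

lemma rho_uminus:
  assumes "finite A"
  shows "rho A (- f) = - rho A f"
proof -
  have "rho A f + rho A (- f) = 0"
    unfolding rho_add[OF assms, symmetric] by (simp only: right_minus rho_0)
  then show ?thesis by (rule minus_unique[symmetric])
qed

lemma rho_eqI:
  assumes "\<And>k. k \<ge> 1 \<Longrightarrow> rho {1..k} f = rho {1..k} g"
  shows "f = g"
proof -
  have "f + - g = 0"
  proof (rule rho_eq_0)
    fix k :: nat assume "k \<ge> 1"
    show "rho {1..k} (f + - g) = 0"
      unfolding rho_add[OF finite_atLeastAtMost] rho_uminus[OF finite_atLeastAtMost]
        assms[OF \<open>k \<ge> 1\<close>] by (rule right_minus)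
  qed
  then show ?thesis by (simp only: add_eq_0_iff2 minus_minus)
qed

instance ringR :: comm_ring_1
proof
  fix a b c :: ringR
  show "a * b * c = a * (b * c)" by (rule rho_eqI) (simp add: rho_mult mult_ac)
  show "a * b = b * a" by (rule rho_eqI) (simp add: rho_mult mult_ac)
  show "1 * a = a" by (rule rho_eqI) (simp add: rho_mult)
  show "(a + b) * c = a * c + b * c" by (rule rho_eqI) (simp add: rho_mult rho_add distrib_right)
  show "(0::ringR) \<noteq> 1"
  proof
    assume "(0::ringR) = 1"
    then have "rho {} 0 = rho {} 1" by simp
    then show False by simp
  qed
qed


section \<open>The ring \<open>R[t\<^sub>0]\<close>\<close>

text \<open>
  \<open>R[t\<^sub>0]\<close> is \<open>ringR poly\<close>, so its ring structure (and \<open>^\<close>) is the one written with a dot in the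
  mathematical text. The elements \<open>t0\<close> and \<open>t1\<close> of \<open>R[t\<^sub>0]\<close> are to be distinguished from the
  polynomials \<open>t 0\<close> and \<open>t 1\<close>: the image of \<open>t1\<close> in \<open>\<rat>[t\<^sub>0, \<dots>, t\<^sub>k]\<close> is \<open>t\<^sub>1 + \<dots> + t\<^sub>k\<close>.
\<close>

definition t0 :: "ringR poly" where
  "t0 = [:0, 1:]"

definition t1 :: "ringR poly" where
  "t1 = [:in_degree 1 (t 1):]"

text \<open>
  For \<open>f(t\<^sub>0, \<dots>, t\<^sub>n) \<in> \<I>\<^sub>n[t\<^sub>0]\<close>, \<open>ev A f x\<close> is the sum of \<open>f(x, t\<^bsub>\<alpha>(1)\<^esub>, \<dots>, t\<^bsub>\<alpha>(n)\<^esub>)\<close> over all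
  strictly increasing \<open>\<alpha> : [1,n] \<rightarrow> A\<close> (lemma \<open>ev_homogeneous\<close>), extended additively to \<open>R[t\<^sub>0]\<close>.
  The canonical homomorphism \<open>R[t\<^sub>0] \<rightarrow> \<rat>[t\<^sub>0, \<dots>, t\<^sub>k]\<close> is \<open>image_at k\<close>.
\<close>

definition ev :: "nat set \<Rightarrow> ringR poly \<Rightarrow> mpoly \<Rightarrow> mpoly" where
  "ev A f x = poly (map_poly (rho A) f) x"

definition image_at :: "nat \<Rightarrow> ringR poly \<Rightarrow> mpoly" where
  "image_at k f = ev {1..k} f (t 0)"

lemma ev_0 [simp]: "ev A 0 x = 0"
  by (simp add: ev_def)

lemma ev_pCons [simp]: "ev A (pCons c p) x = rho A c + x * ev A p x"
  by (simp add: ev_def map_poly_pCons)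

lemma ev_1 [simp]: "ev A 1 x = 1"
  by (simp add: one_pCons)

lemma ev_add: "finite A \<Longrightarrow> ev A (p + q) x = ev A p x + ev A q x"
proof (induction p arbitrary: q rule: pCons_induct)
  case (pCons a p)
  obtain b r where "q = pCons b r" by (cases q)
  moreover have "ev A (p + r) x = ev A p x + ev A r x" using pCons by blast
  ultimately show ?case using pCons.prems by (simp add: rho_add distrib_left add_ac)
qed simp

lemma ev_smult: "finite A \<Longrightarrow> ev A (smult c p) x = rho A c * ev A p x"
  by (induction p rule: pCons_induct) (simp_all add: rho_mult algebra_simps)

lemma ev_mult: "finite A \<Longrightarrow> ev A (p * q) x = ev A p x * ev A q x"
  by (induction p rule: pCons_induct) (simp_all add: ev_add ev_smult algebra_simps)

lemma ev_power: "finite A \<Longrightarrow> ev A (p ^ n) x = ev A p x ^ n"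
  by (induction n) (simp_all add: ev_mult)

lemma ev_uminus:
  assumes "finite A"
  shows "ev A (- p) x = - ev A p x"
proof -
  have "ev A p x + ev A (- p) x = 0"
    unfolding ev_add[OF assms, symmetric] by (simp only: right_minus ev_0)
  then show ?thesis by (rule minus_unique[symmetric])
qed

lemma ev_sum: "finite A \<Longrightarrow> ev A (\<Sum>i\<in>I. f i) x = (\<Sum>i\<in>I. ev A (f i) x)"
  by (induction I rule: infinite_finite_induct) (simp_all add: ev_add)

lemma ev_monom: "ev A (monom c n) x = rho A c * x ^ n"
  by (simp add: ev_def map_poly_monom poly_monom)

lemma ev_of_nat: "finite A \<Longrightarrow> ev A (of_nat n) x = of_nat n"
  by (induction n) (simp_all add: ev_add)

lemma poly_sum_monom: "p = (\<Sum>i\<le>degree p. monom (coeff p i) i)"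
  by (rule poly_as_sum_of_monoms[symmetric])

lemma ev_altdef: "finite A \<Longrightarrow> ev A p x = (\<Sum>i\<le>degree p. rho A (coeff p i) * x ^ i)"
  by (subst poly_sum_monom) (simp add: ev_sum ev_monom)

lemma t_ideal: "t 1 \<in> ideal_t {1..1}"
  by (rule ideal_tI[of _ _ 1]) simp_all

lemma ev_t0 [simp]: "ev A t0 x = x"
  by (simp add: t0_def)

lemma rho_t: "finite A \<Longrightarrow> rho A (in_degree 1 (t 1)) = (\<Sum>i\<in>A. t i)"
proof -
  assume A: "finite A"
  have "(\<Sum>\<alpha>\<in>incr_maps 1 A. t (\<alpha> 1)) = (\<Sum>i\<in>A. t i)"
    by (rule sum.reindex_bij_witness[of _ "\<lambda>i. restrict (\<lambda>_. i) {1..1}" "\<lambda>\<alpha>. \<alpha> 1"])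
      (auto simp: incr_maps_def strict_mono_on_def PiE_iff extensional_def fun_eq_iff)
  then show ?thesis by (simp add: rho_in_degree[OF t_ideal])
qed

lemma ev_t1 [simp]: "finite A \<Longrightarrow> ev A t1 x = (\<Sum>i\<in>A. t i)"
  by (simp add: t1_def rho_t)

lemma image_at_hom:
  "image_at k 1 = 1"
  "image_at k (p + q) = image_at k p + image_at k q"
  "image_at k (p * q) = image_at k p * image_at k q"
  by (simp_all add: image_at_def ev_add ev_mult)

lemma ev_homogeneous:
  assumes "finite A" "\<And>d. coeff f d = in_degree n (F d)" "\<And>d. F d \<in> ideal_t {1..n}"
  shows "ev A f x
    = (\<Sum>\<alpha>\<in>incr_maps n A. \<Sum>d\<le>degree f. subst (\<lambda>i. t (\<alpha> i)) (F d) * x ^ d)"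
  unfolding ev_altdef[OF assms(1)] assms(2) rho_in_degree[OF assms(3)] sum_distrib_right
  by (rule sum.swap)

lemma rho_polys:
  assumes "finite A"
  shows "rho A f \<in> polys A"
  unfolding rho_slot[OF assms]
proof (rule polys_sum)
  fix B assume B: "B \<in> Pow A"
  then have "finite B" using assms finite_subset by auto
  then show "slot f B \<in> polys A"
    using ideal_t_polys[OF slot_ideal] polys_mono B by auto
qed

lemma t0_power_independent:
  assumes "\<And>d. c d \<in> polys {1..k}" "(\<Sum>d\<le>N. c d * t 0 ^ d) = 0" "e \<le> N"
  shows "c e = 0"
proof (rule poly_mapping_eqI)
  fix m0
  show "Poly_Mapping.lookup (c e) m0 = Poly_Mapping.lookup 0 m0"
  proof (cases "0 \<in> Poly_Mapping.keys m0")
    case True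
    then have "m0 \<notin> Poly_Mapping.keys (c e)" using assms(1)[of e] by (force simp: polys_def)
    then show ?thesis by (simp add: in_keys_iff)
  next
    case False
    let ?l = "m0 + Poly_Mapping.single 0 e"
    have "Poly_Mapping.lookup (c d * t 0 ^ d) ?l = (if d = e then Poly_Mapping.lookup (c e) m0 else 0)" for d
    proof -
      have "c d * t 0 ^ d = (\<Sum>m\<in>Poly_Mapping.keys (c d). Poly_Mapping.single m (Poly_Mapping.lookup (c d) m)) * t 0 ^ d"
        by (simp only: sum_monomials[symmetric])
      also have "\<dots> = (\<Sum>m\<in>Poly_Mapping.keys (c d).
          Poly_Mapping.single (m + Poly_Mapping.single 0 d) (Poly_Mapping.lookup (c d) m))"
        by (simp add: t_power sum_distrib_right mult_single)
      finally have *: "Poly_Mapping.lookup (c d * t 0 ^ d) ?l = (\<Sum>m\<in>Poly_Mapping.keys (c d).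
          if m + Poly_Mapping.single 0 d = ?l then Poly_Mapping.lookup (c d) m else 0)"
        by (simp add: lookup_sum lookup_single when_def)
      have "m + Poly_Mapping.single 0 d = ?l \<longleftrightarrow> d = e \<and> m = m0" if "m \<in> Poly_Mapping.keys (c d)" for m
      proof
        assume eq: "m + Poly_Mapping.single 0 d = ?l"
        have "0 \<notin> Poly_Mapping.keys m" using assms(1)[of d] that by (force simp: polys_def)
        then have "Poly_Mapping.lookup (m + Poly_Mapping.single 0 d) 0 = d" "Poly_Mapping.lookup ?l 0 = e"
          using False by (simp_all add: lookup_add in_keys_iff)
        then show "d = e \<and> m = m0" using eq by auto
      qed auto
      then have "Poly_Mapping.lookup (c d * t 0 ^ d) ?l = (\<Sum>m\<in>Poly_Mapping.keys (c d).
          if m = m0 then (if d = e then Poly_Mapping.lookup (c d) m else 0) else 0)"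
        unfolding * by (intro sum.cong refl) auto
      then show ?thesis by (auto simp: in_keys_iff)
    qed
    then have "Poly_Mapping.lookup (\<Sum>d\<le>N. c d * t 0 ^ d) ?l = Poly_Mapping.lookup (c e) m0"
      using assms(3) by (simp add: lookup_sum)
    then show ?thesis using assms(2) by simp
  qed
qed

lemma image_at_eqI:
  assumes "\<And>k. k \<ge> 1 \<Longrightarrow> image_at k f = image_at k g"
  shows "f = g"
proof -
  let ?h = "f + - g"
  have z: "rho {1..k} (coeff ?h d) = 0" if "k \<ge> 1" for k d
  proof (cases "d \<le> degree ?h")
    case True
    have "ev {1..k} ?h (t 0) = 0"
      using assms[OF that] by (simp only: ev_add ev_uminus finite_atLeastAtMost image_at_def) simp
    then have "(\<Sum>d\<le>degree ?h. rho {1..k} (coeff ?h d) * t 0 ^ d) = 0"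
      by (simp only: ev_altdef finite_atLeastAtMost)
    then show ?thesis
      using True by (intro t0_power_independent[of "\<lambda>d. rho {1..k} (coeff ?h d)" k "degree ?h"]) (auto intro: rho_polys)
  next
    case False
    then have "coeff ?h d = 0" by (intro coeff_eq_0) simp
    then show ?thesis by (simp only: rho_0)
  qed
  have "?h = 0"
    by (rule poly_eqI) (use z rho_eq_0 in \<open>simp only: coeff_0\<close>)
  then show ?thesis by (simp only: add_eq_0_iff2 minus_minus)
qed

section \<open>The product \<open>\<odot>\<close>\<close>

text \<open>
  The product is defined by the images of \<open>f \<odot> g\<close> for all \<open>k \<ge> 1\<close>. There is exactly one element with
  these images (lemmas \<open>odot_exists\<close> and \<open>image_at_eqI\<close>), so that \<open>f \<odot> g\<close> satisfies the defining
  equations (lemma \<open>image_at_odot\<close>).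
\<close>

definition odot :: "ringR poly \<Rightarrow> ringR poly \<Rightarrow> ringR poly" (infixl "\<odot>" 70) where
  "f \<odot> g = (THE h. \<forall>k\<ge>1. image_at k h =
     (\<Sum>j=1..k. ev {1..j - 1} f (t 0) * t j * ev {j + 1..k} g (\<Sum>i=0..j. t i)))"

text \<open>
  Auxiliary concatenation product for the existence proof: after expanding powers of
  \<open>(t\<^sub>0 + \<dots> + t\<^bsub>j-1\<^esub>) + t\<^sub>j\<close>, the product \<open>\<odot>\<close> is a combination of these.
\<close>

definition conc :: "nat \<Rightarrow> ringR \<Rightarrow> ringR \<Rightarrow> ringR" where
  "conc b u v = AbsR (\<lambda>n. \<Sum>j=1..n. slot u {1..j - 1} * t j ^ Suc b * slot v {j + 1..n})"

lemma component_conc: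
  "component (conc b u v) n = (\<Sum>j=1..n. slot u {1..j - 1} * t j ^ Suc b * slot v {j + 1..n})"
proof -
  let ?h = "\<lambda>n. \<Sum>j=1..n. slot u {1..j - 1} * t j ^ Suc b * slot v {j + 1..n}"
  obtain N where N: "\<And>n. n \<ge> N \<Longrightarrow> component u n = 0" using component_bound[of u] by blast
  obtain M where M: "\<And>n. n \<ge> M \<Longrightarrow> component v n = 0" using component_bound[of v] by blast
  have zero: "?h n = 0" if "n \<ge> N + M + 1" for n
  proof (intro sum.neutral ballI)
    fix j assume j: "j \<in> {1..n}"
    have "j - 1 \<ge> N \<or> n - j \<ge> M" using that j by auto
    then show "slot u {1..j - 1} * t j ^ Suc b * slot v {j + 1..n} = 0"
      by (auto simp: slot_def N M)
  qed
  have "finite {n. ?h n \<noteq> 0}"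
  proof (rule finite_subset[of _ "{..<N + M + 1}"])
    show "{n. ?h n \<noteq> 0} \<subseteq> {..<N + M + 1}"
      using zero by (auto simp: not_less[symmetric] simp del: not_less)
  qed simp
  moreover have "?h n \<in> ideal_t {1..n}" for n
  proof (intro ideal_t_sum)
    fix j assume j: "j \<in> {1..n}"
    have "t j ^ Suc b \<in> ideal_t {j}"
      by (rule ideal_tI[of _ _ "t j ^ b"]) (auto intro: polys_power)
    then have "slot u {1..j - 1} * t j ^ Suc b * slot v {j + 1..n} \<in> ideal_t (({1..j - 1} \<union> {j}) \<union> {j + 1..n})"
      by (intro ideal_t_mult slot_ideal) auto
    moreover have "({1..j - 1} \<union> {j}) \<union> {j + 1..n} = {1..n}" using j by auto
    ultimately show "slot u {1..j - 1} * t j ^ Suc b * slot v {j + 1..n} \<in> ideal_t {1..n}" by simp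
  qed
  ultimately show ?thesis
    unfolding conc_def by (subst AbsR_inverse) auto
qed

lemma slot_conc:
  assumes "finite C"
  shows "slot (conc b u v) C = (\<Sum>j\<in>C. slot u {i\<in>C. i < j} * t j ^ Suc b * slot v {i\<in>C. j < i})"
proof -
  let ?A = "{1..card C}"
  have sm: "strict_mono_on ?A (inc C)" and im: "inc C ` ?A = C"
    using inc_incr_maps[OF assms order.refl] inc_image[OF assms] by (auto simp: incr_maps_def)
  have "slot (conc b u v) C
     = (\<Sum>j\<in>?A. slot u {i\<in>C. i < inc C j} * t (inc C j) ^ Suc b * slot v {i\<in>C. inc C j < i})"
    unfolding slot_def[of "conc b u v"] component_conc subst_sum subst_mult subst_power subst_t
  proof (intro sum.cong refl arg_cong2[of _ _ _ _ "(*)"])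
    fix j assume j: "j \<in> ?A"
    have "inc C ` {1..j - 1} = inc C ` {i\<in>?A. inc C i < inc C j}"
      using strict_mono_on_less[OF sm] j by (intro arg_cong[of _ _ "image (inc C)"]) auto
    also have "\<dots> = {i \<in> inc C ` ?A. i < inc C j}" by blast
    finally have 1: "inc C ` {1..j - 1} = {i\<in>C. i < inc C j}" using im by simp
    have "inc C ` {j + 1..card C} = inc C ` {i\<in>?A. inc C j < inc C i}"
      using strict_mono_on_less[OF sm] j by (intro arg_cong[of _ _ "image (inc C)"]) auto
    also have "\<dots> = {i \<in> inc C ` ?A. inc C j < i}" by blast
    finally have 2: "inc C ` {j + 1..card C} = {i\<in>C. inc C j < i}" using im by simp
    show "subst (\<lambda>i. t (inc C i)) (slot u {1..j - 1}) = slot u {i\<in>C. i < inc C j}"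
    proof -
      have "{1..j - 1} \<subseteq> ?A" using j by auto
      then show ?thesis using subst_slot[OF assms, of "{1..j - 1}" u] 1 by simp
    qed
    show "subst (\<lambda>i. t (inc C i)) (slot v {j + 1..card C}) = slot v {i\<in>C. inc C j < i}"
    proof -
      have "{j + 1..card C} \<subseteq> ?A" using j by auto
      then show ?thesis using subst_slot[OF assms, of "{j + 1..card C}" v] 2 by simp
    qed
  qed
  also have "\<dots> = (\<Sum>j\<in>C. slot u {i\<in>C. i < j} * t j ^ Suc b * slot v {i\<in>C. j < i})"
    by (rule sum.reindex_bij_betw[OF inc_bij[OF assms]])
  finally show ?thesis .
qed

lemma rho_conc:
  "rho {1..k} (conc b u v)
     = (\<Sum>j=1..k. rho {1..j - 1} u * t j ^ Suc b * rho {j + 1..k} v)"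
proof -
  let ?F = "\<lambda>j P Q. slot u P * t j ^ Suc b * slot v Q"
  have "rho {1..k} (conc b u v)
      = (\<Sum>C\<in>Pow {1..k}. \<Sum>j\<in>C. ?F j {i\<in>C. i < j} {i\<in>C. j < i})"
    unfolding rho_slot[OF finite_atLeastAtMost]
  proof (intro sum.cong refl)
    fix C assume "C \<in> Pow {1..k}"
    then have "finite C" using finite_subset by auto
    then show "slot (conc b u v) C = (\<Sum>j\<in>C. ?F j {i\<in>C. i < j} {i\<in>C. j < i})" by (rule slot_conc)
  qed
  also have "\<dots> = (\<Sum>(C, j)\<in>(SIGMA C:Pow {1..k}. C). ?F j {i\<in>C. i < j} {i\<in>C. j < i})"
    by (rule sum.Sigma) (auto intro: finite_subset)
  also have "\<dots> = (\<Sum>(j, P, Q)\<in>(SIGMA j:{1..k}. Pow {1..j - 1} \<times> Pow {j + 1..k}). ?F j P Q)"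
  proof (rule sum.reindex_bij_witness[of _ "\<lambda>(j, P, Q). (insert j (P \<union> Q), j)"
        "\<lambda>(C, j). (j, {i\<in>C. i < j}, {i\<in>C. j < i})"])
    fix x assume "x \<in> (SIGMA j:{1..k}. Pow {1..j - 1} \<times> Pow {j + 1..k})"
    then obtain j P Q where x: "x = (j, P, Q)" "j \<in> {1..k}" "P \<subseteq> {1..j - 1}" "Q \<subseteq> {j + 1..k}" by auto
    then have lt: "\<And>i. i \<in> P \<Longrightarrow> 1 \<le> i \<and> i < j" "\<And>i. i \<in> Q \<Longrightarrow> j < i \<and> i \<le> k" by fastforce+
    have "{i \<in> insert j (P \<union> Q). i < j} = P" "{i \<in> insert j (P \<union> Q). j < i} = Q"
      using lt by fastforce+
    then show "(case case x of (j, P, Q) \<Rightarrow> (insert j (P \<union> Q), j) of (C, j) \<Rightarrow> (j, {i\<in>C. i < j}, {i\<in>C. j < i})) = x"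
      using x by simp
    have "insert j (P \<union> Q) \<subseteq> {1..k}" using lt x(2) by fastforce
    then show "(case x of (j, P, Q) \<Rightarrow> (insert j (P \<union> Q), j)) \<in> (SIGMA C:Pow {1..k}. C)"
      using x by simp
  next
    fix x assume "x \<in> (SIGMA C:Pow {1..k}. C)"
    then obtain C j where x: "x = (C, j)" "C \<subseteq> {1..k}" "j \<in> C" by auto
    have "insert j ({i\<in>C. i < j} \<union> {i\<in>C. j < i}) = C" using x(3) by auto
    then show "(case case x of (C, j) \<Rightarrow> (j, {i\<in>C. i < j}, {i\<in>C. j < i}) of (j, P, Q) \<Rightarrow> (insert j (P \<union> Q), j)) = x"
      using x by simp
    show "(case x of (C, j) \<Rightarrow> (j, {i\<in>C. i < j}, {i\<in>C. j < i})) \<in> (SIGMA j:{1..k}. Pow {1..j - 1} \<times> Pow {j + 1..k})"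
      using x by fastforce
    show "(case case x of (C, j) \<Rightarrow> (j, {i\<in>C. i < j}, {i\<in>C. j < i}) of (j, P, Q) \<Rightarrow> ?F j P Q)
        = (case x of (C, j) \<Rightarrow> ?F j {i\<in>C. i < j} {i\<in>C. j < i})"
      using x by simp
  qed
  also have "\<dots> = (\<Sum>j=1..k. \<Sum>(P, Q)\<in>Pow {1..j - 1} \<times> Pow {j + 1..k}. ?F j P Q)"
    by (subst sum.Sigma) auto
  also have "\<dots> = (\<Sum>j=1..k. rho {1..j - 1} u * t j ^ Suc b * rho {j + 1..k} v)"
    by (intro sum.cong refl)
      (simp add: rho_slot sum.cartesian_product[symmetric] sum_distrib_left sum_distrib_right mult_ac)
  finally show ?thesis .
qed

lemma odot_exists:
  "\<exists>h. \<forall>k\<ge>1. image_at k h =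
     (\<Sum>j=1..k. ev {1..j - 1} f (t 0) * t j * ev {j + 1..k} g (\<Sum>i=0..j. t i))"
proof -
  define U where "U a = f * (t0 + t1) ^ a" for a
  define h where "h = (\<Sum>d\<le>degree g. \<Sum>a\<le>d. of_nat (d choose a) *
     (\<Sum>e\<le>degree (U a). monom (conc (d - a) (coeff (U a) e) (coeff g d)) e))"
  have "image_at k h = (\<Sum>j=1..k. ev {1..j - 1} f (t 0) * t j * ev {j + 1..k} g (\<Sum>i=0..j. t i))"
    for k
  proof -
    let ?x = "\<lambda>j. t 0 + (\<Sum>i=1..j - 1. t i)"
    have inner: "(\<Sum>e\<le>degree (U a). rho {1..k} (conc b (coeff (U a) e) v) * t 0 ^ e)
      = (\<Sum>j=1..k. ev {1..j - 1} f (t 0) * ?x j ^ a * t j ^ Suc b * rho {j + 1..k} v)" for a b v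
    proof -
      have "(\<Sum>e\<le>degree (U a). rho {1..k} (conc b (coeff (U a) e) v) * t 0 ^ e)
         = (\<Sum>j=1..k. \<Sum>e\<le>degree (U a). rho {1..j - 1} (coeff (U a) e) * t j ^ Suc b * rho {j + 1..k} v * t 0 ^ e)"
        unfolding rho_conc sum_distrib_right by (rule sum.swap)
      also have "\<dots> = (\<Sum>j=1..k. ev {1..j - 1} (U a) (t 0) * (t j ^ Suc b * rho {j + 1..k} v))"
        by (intro sum.cong refl) (simp add: ev_altdef sum_distrib_left sum_distrib_right mult_ac)
      also have "\<dots> = (\<Sum>j=1..k. ev {1..j - 1} f (t 0) * ?x j ^ a * t j ^ Suc b * rho {j + 1..k} v)"
        by (intro sum.cong refl) (simp add: U_def ev_mult ev_power ev_add mult_ac)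
      finally show ?thesis .
    qed
    have "image_at k h = (\<Sum>d\<le>degree g. \<Sum>a\<le>d. of_nat (d choose a) *
      (\<Sum>j=1..k. ev {1..j - 1} f (t 0) * ?x j ^ a * t j ^ Suc (d - a) * rho {j + 1..k} (coeff g d)))"
      unfolding image_at_def h_def
      by (simp only: ev_sum ev_mult ev_of_nat ev_monom finite_atLeastAtMost inner)
    also have "\<dots> = (\<Sum>d\<le>degree g. \<Sum>a\<le>d. \<Sum>j=1..k. of_nat (d choose a) *
      (ev {1..j - 1} f (t 0) * ?x j ^ a * t j ^ Suc (d - a) * rho {j + 1..k} (coeff g d)))"
      by (simp only: sum_distrib_left)
    also have "\<dots> = (\<Sum>d\<le>degree g. \<Sum>j=1..k. \<Sum>a\<le>d. of_nat (d choose a) *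
      (ev {1..j - 1} f (t 0) * ?x j ^ a * t j ^ Suc (d - a) * rho {j + 1..k} (coeff g d)))"
      by (intro sum.cong refl sum.swap)
    also have "\<dots> = (\<Sum>j=1..k. \<Sum>d\<le>degree g. \<Sum>a\<le>d. of_nat (d choose a) *
      (ev {1..j - 1} f (t 0) * ?x j ^ a * t j ^ Suc (d - a) * rho {j + 1..k} (coeff g d)))"
      by (rule sum.swap)
    also have "\<dots> = (\<Sum>j=1..k. ev {1..j - 1} f (t 0) * t j * ev {j + 1..k} g (\<Sum>i=0..j. t i))"
    proof (intro sum.cong refl)
      fix j assume j: "j \<in> {1..k}"
      have "{0..j} = insert 0 (insert j {1..j - 1})" using j by auto
      moreover have "0 \<noteq> j" using j by simp
      ultimately have x: "(\<Sum>i=0..j. t i) = ?x j + t j" using j by (simp add: add_ac)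
      have "(\<Sum>d\<le>degree g. \<Sum>a\<le>d. of_nat (d choose a) *
          (ev {1..j - 1} f (t 0) * ?x j ^ a * t j ^ Suc (d - a) * rho {j + 1..k} (coeff g d)))
        = (\<Sum>d\<le>degree g. ev {1..j - 1} f (t 0) * t j * (rho {j + 1..k} (coeff g d) * (?x j + t j) ^ d))"
        unfolding binomial_ring[of "?x j" "t j"] sum_distrib_left
        by (intro sum.cong refl) (simp add: mult_ac)
      also have "\<dots> = ev {1..j - 1} f (t 0) * t j * ev {j + 1..k} g (\<Sum>i=0..j. t i)"
        unfolding x by (simp only: ev_altdef finite_atLeastAtMost sum_distrib_left)
      finally show "(\<Sum>d\<le>degree g. \<Sum>a\<le>d. of_nat (d choose a) *
          (ev {1..j - 1} f (t 0) * ?x j ^ a * t j ^ Suc (d - a) * rho {j + 1..k} (coeff g d)))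
        = ev {1..j - 1} f (t 0) * t j * ev {j + 1..k} g (\<Sum>i=0..j. t i)" .
    qed
    finally show ?thesis .
  qed
  then show ?thesis by blast
qed

lemma image_at_odot:
  assumes "k \<ge> 1"
  shows "image_at k (f \<odot> g) =
     (\<Sum>j=1..k. ev {1..j - 1} f (t 0) * t j * ev {j + 1..k} g (\<Sum>i=0..j. t i))"
proof -
  have "\<exists>!h. \<forall>k\<ge>1. image_at k h =
     (\<Sum>j=1..k. ev {1..j - 1} f (t 0) * t j * ev {j + 1..k} g (\<Sum>i=0..j. t i))"
    using odot_exists[of f g] by (rule ex_ex1I) (rule image_at_eqI, simp)
  from theI'[OF this] show ?thesis
    using assms unfolding odot_def by blast
qed

lemma odot_add_left: "(f + f') \<odot> g = f \<odot> g + f' \<odot> g"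
  by (rule image_at_eqI)
    (simp add: image_at_odot image_at_hom ev_add distrib_right sum.distrib)

lemma odot_add_right: "f \<odot> (g + g') = f \<odot> g + f \<odot> g'"
  by (rule image_at_eqI)
    (simp add: image_at_odot image_at_hom ev_add distrib_left sum.distrib)

definition scalar :: "rat \<Rightarrow> ringR" where
  "scalar c = in_degree 0 (Poly_Mapping.single 0 c)"

lemma rho_scalar [simp]: "rho A (scalar c) = Poly_Mapping.single 0 c"
  by (simp add: scalar_def rho_in_degree_0)

lemma image_at_smult: "image_at k (smult c f) = rho {1..k} c * image_at k f"
  by (simp add: image_at_def ev_smult)

lemma odot_scalar_left: "smult (scalar c) f \<odot> g = smult (scalar c) (f \<odot> g)"
  by (rule image_at_eqI)
    (simp add: image_at_odot image_at_smult ev_smult sum_distrib_left mult_ac)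

lemma odot_scalar_right: "f \<odot> smult (scalar c) g = smult (scalar c) (f \<odot> g)"
  by (rule image_at_eqI)
    (simp add: image_at_odot image_at_smult ev_smult sum_distrib_left mult_ac)

declare One_nat_def [simp]

end

theory Submission
  imports Defs
begin

text \<open>Compare images for all k. In the j-th summand of the left side, gluing replaces t_0 by
  t_0 + ... + t_j, and \<open>t1\<close> on [j+1,k] supplies exactly the missing t_{j+1} + ... +
  t_k. The n-th power is thus independent of j, and the remaining factors t_j add up to the image of
  \<open>t1\<close>.\<close>

theorem lemma8p3:
  fixes n :: nat
  shows "1 \<odot> (t0 + t1) ^ n = t1 * (t0 + t1) ^ n"
proof (rule image_at_eqI)
  fix k :: nat assume "k \<ge> 1"
  have "image_at k (1 \<odot> (t0 + t1) ^ n)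
      = (\<Sum>j=1..k. t j * ((\<Sum>i=0..j. t i) + (\<Sum>i=j+1..k. t i)) ^ n)"
    using \<open>k \<ge> 1\<close> by (simp add: image_at_odot ev_power ev_add)
  also have "\<dots> = (\<Sum>j=1..k. t j * (\<Sum>i=0..k. t i) ^ n)"
  proof (intro sum.cong refl)
    fix j assume "j \<in> {1..k}"
    then have "(\<Sum>i=0..j. t i) + (\<Sum>i=j+1..k. t i) = (\<Sum>i=0..k. t i)"
      using sum.ub_add_nat[of 0 j t "k - j"] by simp
    then show "t j * ((\<Sum>i=0..j. t i) + (\<Sum>i=j+1..k. t i)) ^ n = t j * (\<Sum>i=0..k. t i) ^ n"
      by simp
  qed
  also have "\<dots> = image_at k (t1 * (t0 + t1) ^ n)"
    \<comment> \<open>Splitting off the term i = 0 turns the full sum into the image of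
      \<open>t0 + t1\<close>.\<close>
    by (simp add: image_at_def ev_mult ev_power ev_add sum_distrib_right sum.atLeast_Suc_atMost)
  finally show "image_at k (1 \<odot> (t0 + t1) ^ n) = image_at k (t1 * (t0 + t1) ^ n)" .
qed

end
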